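(* Let $d\ge1$ and consider the infinite color urn model with colors indexed by $\mathbb{Z}^d$ associated with the bounded increment random walk with increments $\{X_j\}_{j\ge1}$; let $Z_n$ be the color of the $(n+1)$-th selected ball. Then for each $n\ge1$, $$Z_n\stackrel{d}{=}Z_0+\sum_{j=1}^nI_jX_j,$$ where on the right-hand side $\{I_j\}_{j\ge1}$ are independent Bernoulli random variables with $\mathbb{E}[I_j]=\frac{1}{j+1}$, $j\ge1$, independent of $\{X_j\}_{j\ge1}$, and $Z_0$ is a random vector taking values in $\mathbb{Z}^d$ distributed according to the probability vector $U_0$ and independent of $\left(\{I_j\}_{j\ge1};\{X_j\}_{j\ge1}\right)$.
   Context: $\{X_j\}_{j\ge1}$ are i.i.d. random vectors in $\mathbb{Z}^d$ with probability mass function $p(u)=\mathbb{P}(X_1=u)$, and there is a finite non-empty $B\subseteq\mathbb{Z}^d$ with $p(u)=0$ for $u\notin B$. The matrix $\varSigma:=\mathbb{E}[X_1^TX_1]$ ($X_1$ a row vector) is assumed positive definite. Urn model: let $R=((p(v-u)))_{u,v\in\mathbb{Z}^d}$ and let $R_u$ be the $u$-th row of $R$. The initial configuration $U_0=(U_{0,v})_{v\in\mathbb{Z}^d}$ is a (non-random) probability vector with only finitely many non-zero entries. For $n\ge0$, the color $Z_n\in\mathbb{Z}^d$ of the $(n+1)$-th selected ball satisfies $\mathbb{P}(Z_n=v\mid U_n,\dots,U_0)=U_{n,v}/(n+1)$, $v\in\mathbb{Z}^d$, and $U_{n+1}=U_n+R_{Z_n}$, i.e. $U_{n+1,v}=U_{n,v}+p(v-Z_n)$.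 (So $\sum_v U_{n,v}=n+1$.) $\stackrel{d}{=}$ denotes equality in distribution. *)

theory Defs
  imports "HOL-Probability.Probability"
begin

text \<open>The lattice is \<open>int ^ 'd\<close> with the discrete \<open>\<sigma>\<close>-algebra
  \<open>count_space UNIV\<close>; its dimension is \<open>CARD('d)\<close>.\<close>

definition second_moment_matrix :: "'w measure \<Rightarrow> ('w \<Rightarrow> int ^ 'd) \<Rightarrow> real ^ 'd ^ 'd" where
  "second_moment_matrix M X =
     (\<chi> i j. \<integral>\<omega>. real_of_int (X \<omega> $ i) * real_of_int (X \<omega> $ j) \<partial>M)"

definition positive_definite :: "real ^ 'd ^ 'd \<Rightarrow> bool" where
  "positive_definite A \<longleftrightarrow> transpose A = A \<and> (\<forall>x. x \<noteq> 0 \<longrightarrow> x \<bullet> (A *v x) > 0)"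

definition replacement_matrix :: "(int ^ 'd) pmf \<Rightarrow> int ^ 'd \<Rightarrow> int ^ 'd \<Rightarrow> real" where
  "replacement_matrix p u v = pmf p (v - u)"

text \<open>The library's \<open>prob_space.indep_var\<close> requires both variables to have the same value type.
  This version has no such restriction and agrees with it when the types
  coincide.\<close>

definition indep_rv ::
    "'w measure \<Rightarrow> 'a measure \<Rightarrow> ('w \<Rightarrow> 'a) \<Rightarrow> 'b measure \<Rightarrow> ('w \<Rightarrow> 'b) \<Rightarrow> bool" where
  "indep_rv M S X T Y \<longleftrightarrow>
     X \<in> M \<rightarrow>\<^sub>M S \<and> Y \<in> M \<rightarrow>\<^sub>M T \<and>
     prob_space.indep_set M
       (sets (vimage_algebra (space M) X S)) (sets (vimage_algebra (space M) Y T))"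

lemma (in prob_space) indep_rv_iff_indep_var: "indep_rv M S X T Y \<longleftrightarrow> indep_var S X T Y"
  by (auto simp: indep_rv_def indep_var_eq sets_vimage_algebra)

text \<open>The \<open>\<sigma>\<close>-algebra on \<open>\<Omega>\<close> generated by the configurations \<open>U 0, \<dots>, U n\<close>.\<close>

definition configuration_history ::
    "'w set \<Rightarrow> (nat \<Rightarrow> 'w \<Rightarrow> int ^ 'd \<Rightarrow> real) \<Rightarrow> nat \<Rightarrow> 'w measure" where
  "configuration_history \<Omega> U n =
     vimage_algebra \<Omega> (\<lambda>\<omega>. \<lambda>k\<in>{..n}. U k \<omega>) (PiM {..n} (\<lambda>_. PiM UNIV (\<lambda>_. borel)))"

text \<open>\<open>U n \<omega> v\<close> is the weight of color \<open>v\<close> after \<open>n\<close> draws, and \<open>Z n \<omega>\<close> is the color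
  of the \<open>(n + 1)\<close>-th selected ball. The initial configuration is the probability vector
  \<open>pmf u0\<close>.\<close>

locale infinite_color_urn = prob_space M
  for M :: "'w measure"
  and p :: "(int ^ 'd) pmf"
  and u0 :: "(int ^ 'd) pmf"
  and U :: "nat \<Rightarrow> 'w \<Rightarrow> int ^ 'd \<Rightarrow> real"
  and Z :: "nat \<Rightarrow> 'w \<Rightarrow> int ^ 'd" +
  assumes finite_initial: "finite (set_pmf u0)"
    and U_measurable: "\<And>n. U n \<in> M \<rightarrow>\<^sub>M PiM UNIV (\<lambda>_. borel)"
    and Z_measurable: "\<And>n. Z n \<in> M \<rightarrow>\<^sub>M count_space UNIV"
    and U_0: "\<And>\<omega>. \<omega> \<in> space M \<Longrightarrow> U 0 \<omega> = pmf u0"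
    and U_Suc: "\<And>n \<omega> v. \<omega> \<in> space M \<Longrightarrow>
      U (Suc n) \<omega> v = U n \<omega> v + replacement_matrix p (Z n \<omega>) v"
    and Z_conditional: "\<And>n v. AE \<omega> in M.
      real_cond_exp M (configuration_history (space M) U n) (indicator {\<omega> \<in> space M. Z n \<omega> = v}) \<omega>
        = U n \<omega> v / (real n + 1)"

end

theory Submission
  imports Defs
begin

text \<open>Write \<open>q\<^sub>n = 1 / (n + 2)\<close>. Both \<open>Z\<^sub>n\<close> and the lazy walk
  \<open>S\<^sub>n = Z\<^sub>0 + I\<^sub>1 X\<^sub>1 + \<dots> + I\<^sub>n X\<^sub>n\<close> have a mass function \<open>f\<^sub>n\<close> which starts at \<open>u\<^sub>0\<close> and solves
  \<open>f\<^sub>n\<^sub>+\<^sub>1(v) = (1 - q\<^sub>n) f\<^sub>n(v) + q\<^sub>n \<Sum>\<^sub>x p(x) f\<^sub>n(v - x)\<close>,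
  so the two mass functions agree for every \<open>n\<close>.

  For the urn, integrating the conditional law of the drawn color shows that \<open>(n + 1) f\<^sub>n(v)\<close> is the
  expected weight of \<open>v\<close> (\<open>expectation_weight\<close>). The expected weight grows in one draw by
  \<open>E p(v - Z\<^sub>n)\<close>, which is the convolution of \<open>p\<close> with \<open>f\<^sub>n\<close>; dividing by \<open>n + 2\<close> gives the recursion
  (\<open>prob_draw_Suc\<close>).

  For the walk, the recursion is the total probability over the two values of \<open>I\<^sub>n\<^sub>+\<^sub>1\<close>
  (\<open>prob_lazy_step\<close>). It needs \<open>S\<^sub>n\<close> to be independent of the pair \<open>(X\<^sub>n\<^sub>+\<^sub>1, I\<^sub>n\<^sub>+\<^sub>1)\<close>, whereas the
  hypotheses describe independence inside each of the two sequences, between them, and of \<open>Z\<^sub>0\<close> from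
  both. These are assembled into the independence of the single sequence
  \<open>Z\<^sub>0, (X\<^sub>1, I\<^sub>1), (X\<^sub>2, I\<^sub>2), \<dots>\<close> (\<open>indep_vars_start_and_steps\<close>).\<close>

section \<open>The color of a drawn ball\<close>

context infinite_color_urn
begin

lemma weight_bounds:
  assumes "\<omega> \<in> space M"
  shows "0 \<le> U n \<omega> v" "U n \<omega> v \<le> real n + 1"
proof (induction n)
  case 0
  { case 1 then show ?case by (simp add: U_0 assms) }
  { case 2 then show ?case by (simp add: U_0 assms pmf_le_1) }
next
  case (Suc n)
  { case 1 then show ?case using Suc by (simp add: U_Suc assms replacement_matrix_def) }
  { case 2
    then show ?case
      using Suc pmf_le_1[of p "v - Z n \<omega>"] by (simp add: U_Suc assms replacement_matrix_def) }
qed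

lemma integrable_weight: "integrable M (\<lambda>\<omega>. U n \<omega> v)"
proof (rule integrable_const_bound[where B = "real n + 1"])
  show "AE \<omega> in M. norm (U n \<omega> v) \<le> real n + 1"
    using weight_bounds[of _ n v] by (auto intro!: AE_I2)
  show "(\<lambda>\<omega>. U n \<omega> v) \<in> borel_measurable M"
    using measurable_compose[OF U_measurable[of n] measurable_component_singleton[of v UNIV]] by simp
qed

lemma draw_event [measurable]: "{\<omega> \<in> space M. Z n \<omega> = v} \<in> sets M"
  using measurable_sets[OF Z_measurable[of n], of "{v}"] by (simp add: vimage_def Int_def conj_commute)

lemma subalgebra_configuration_history: "subalgebra M (configuration_history (space M) U n)"
  unfolding subalgebra_def configuration_history_def
  by (intro conjI sets_image_in_sets measurable_restrict U_measurable) simp_all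

text \<open>A conditional expectation has the same integral as the variable itself, so integrating
  \<open>P(Z\<^sub>n = v | U\<^sub>0, \<dots>, U\<^sub>n) = U\<^sub>n\<^sub>,\<^sub>v / (n + 1)\<close> removes the conditioning.\<close>

lemma expectation_weight: "expectation (\<lambda>\<omega>. U n \<omega> v) = (real n + 1) * prob {\<omega> \<in> space M. Z n \<omega> = v}"
proof -
  let ?F = "configuration_history (space M) U n"
  let ?ind = "indicator {\<omega> \<in> space M. Z n \<omega> = v} :: 'w \<Rightarrow> real"
  interpret finite_measure_subalgebra M ?F
    by unfold_locales (rule subalgebra_configuration_history)
  have "integrable M ?ind"
    by (intro integrable_real_indicator draw_event) (simp add: emeasure_eq_measure)
  then have "expectation ?ind = expectation (real_cond_exp M ?F ?ind)"
    by (simp add: real_cond_exp_int(2))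
  also have "\<dots> = expectation (\<lambda>\<omega>. U n \<omega> v / (real n + 1))"
    by (rule integral_cong_AE) (use Z_conditional integrable_weight in auto)
  finally have "prob {\<omega> \<in> space M. Z n \<omega> = v} = expectation (\<lambda>\<omega>. U n \<omega> v) / (real n + 1)"
    by (simp add: Int_absorb2)
  then show ?thesis by simp
qed

lemma prob_draw_0: "prob {\<omega> \<in> space M. Z 0 \<omega> = v} = pmf u0 v"
proof -
  have "expectation (\<lambda>\<omega>. U 0 \<omega> v) = expectation (\<lambda>_. pmf u0 v)"
    by (rule Bochner_Integration.integral_cong) (simp_all add: U_0)
  then show ?thesis using expectation_weight[of 0 v] by (simp add: prob_space)
qed

text \<open>Take expectations in the replacement rule and divide by the total weight \<open>n + 2\<close>: the old balls
  contribute \<open>(n + 1) / (n + 2) = 1 - 1 / (n + 2)\<close> of it, the last replacement the rest.\<close>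

lemma prob_draw_Suc:
  assumes "finite B" and p_support: "\<And>u. u \<notin> B \<Longrightarrow> pmf p u = 0"
  shows "prob {\<omega> \<in> space M. Z (Suc n) \<omega> = v} =
      (1 - 1 / (real n + 2)) * prob {\<omega> \<in> space M. Z n \<omega> = v}
      + 1 / (real n + 2) * (\<Sum>x\<in>B. pmf p x * prob {\<omega> \<in> space M. Z n \<omega> = v - x})"
proof -
  have int: "integrable M (\<lambda>\<omega>. indicator {\<omega> \<in> space M. Z n \<omega> = w} \<omega> :: real)" for w
    by (intro integrable_real_indicator draw_event) (simp add: emeasure_eq_measure)
  \<comment> \<open>The finite support turns the random increment into a finite combination of events about \<open>Z n\<close>,
    whose expectation is a convolution.\<close>
  have replacement: "pmf p (v - Z n \<omega>) =
      (\<Sum>x\<in>B. pmf p x * indicator {\<omega> \<in> space M. Z n \<omega> = v - x} \<omega>)"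
    if "\<omega> \<in> space M" for \<omega>
  proof -
    have "(\<Sum>x\<in>B. pmf p x * indicator {\<omega> \<in> space M. Z n \<omega> = v - x} \<omega>) =
        (\<Sum>x\<in>B. if x = v - Z n \<omega> then pmf p x else 0)"
      using that by (intro sum.cong) (auto simp: indicator_def algebra_simps)
    also have "\<dots> = pmf p (v - Z n \<omega>)"
      using \<open>finite B\<close> p_support by (simp add: sum.delta)
    finally show ?thesis by simp
  qed
  have "expectation (\<lambda>\<omega>. U (Suc n) \<omega> v) = expectation (\<lambda>\<omega>. U n \<omega> v +
      (\<Sum>x\<in>B. pmf p x * indicator {\<omega> \<in> space M. Z n \<omega> = v - x} \<omega>))"
    by (rule Bochner_Integration.integral_cong)
      (simp_all add: U_Suc replacement_matrix_def replacement)
  also have "\<dots> = expectation (\<lambda>\<omega>. U n \<omega> v) +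
      (\<Sum>x\<in>B. pmf p x * expectation (indicator {\<omega> \<in> space M. Z n \<omega> = v - x}))"
    using int integrable_weight
    by (simp add: Bochner_Integration.integral_add Bochner_Integration.integral_sum)
  also have "\<dots> = (real n + 1) * prob {\<omega> \<in> space M. Z n \<omega> = v} +
      (\<Sum>x\<in>B. pmf p x * prob {\<omega> \<in> space M. Z n \<omega> = v - x})"
    by (simp add: expectation_weight Int_absorb2)
  finally have "(real n + 2) * prob {\<omega> \<in> space M. Z (Suc n) \<omega> = v} =
      (real n + 1) * prob {\<omega> \<in> space M. Z n \<omega> = v} +
      (\<Sum>x\<in>B. pmf p x * prob {\<omega> \<in> space M. Z n \<omega> = v - x})"
    using expectation_weight[of "Suc n" v] by (simp add: add.commute)
  moreover have "y = (1 - 1 / (real n + 2)) * a + 1 / (real n + 2) * b"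
    if "(real n + 2) * y = (real n + 1) * a + b" for y a b :: real
  proof -
    have "y = ((real n + 1) * a + b) / (real n + 2)" unfolding that[symmetric] by simp
    then show ?thesis by (simp add: divide_simps)
  qed
  ultimately show ?thesis by blast
qed

end

section \<open>Independence of variables with different value types\<close>

context prob_space
begin

lemma indep_rv_iff_prob:
  "indep_rv M S X T Y \<longleftrightarrow>
     X \<in> M \<rightarrow>\<^sub>M S \<and> Y \<in> M \<rightarrow>\<^sub>M T \<and>
     (\<forall>A\<in>sets S. \<forall>C\<in>sets T. prob ((X -` A \<inter> space M) \<inter> (Y -` C \<inter> space M)) =
        prob (X -` A \<inter> space M) * prob (Y -` C \<inter> space M))"
  (is "?L \<longleftrightarrow> ?R")
proof (cases "X \<in> M \<rightarrow>\<^sub>M S \<and> Y \<in> M \<rightarrow>\<^sub>M T")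
  case True
  then have X: "X \<in> M \<rightarrow>\<^sub>M S" and Y: "Y \<in> M \<rightarrow>\<^sub>M T" by auto
  have sX: "sets (vimage_algebra (space M) X S) = {X -` A \<inter> space M | A. A \<in> sets S}"
    and sY: "sets (vimage_algebra (space M) Y T) = {Y -` A \<inter> space M | A. A \<in> sets T}"
    using X Y by (auto intro!: sets_vimage_algebra2 dest: measurable_space)
  show ?thesis
  proof
    assume ?L
    then have "indep_set {X -` A \<inter> space M | A. A \<in> sets S} {Y -` A \<inter> space M | A. A \<in> sets T}"
      by (simp add: indep_rv_def sX sY)
    from indep_setD[OF this] X Y show ?R by blast
  next
    assume R: ?R
    have "indep_set {X -` A \<inter> space M | A. A \<in> sets S} {Y -` A \<inter> space M | A. A \<in> sets T}"
      using R by (intro indep_setI) (auto intro: measurable_sets)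
    with X Y show ?L by (simp add: indep_rv_def sX sY)
  qed
qed (auto simp: indep_rv_def)

lemma indep_rvD:
  assumes "indep_rv M S X T Y" "A \<in> sets S" "C \<in> sets T"
  shows "prob ((X -` A \<inter> space M) \<inter> (Y -` C \<inter> space M)) =
    prob (X -` A \<inter> space M) * prob (Y -` C \<inter> space M)"
  using assms by (simp add: indep_rv_iff_prob)

lemma indep_rv_components:
  assumes "indep_rv M (PiM K S) (\<lambda>\<omega>. \<lambda>j\<in>K. X j \<omega>) (PiM L T) (\<lambda>\<omega>. \<lambda>j\<in>L. Y j \<omega>)"
    and "k \<in> K" "l \<in> L"
  shows "indep_rv M (S k) (X k) (T l) (Y l)"
proof -
  have X: "(\<lambda>\<omega>. \<lambda>j\<in>K. X j \<omega>) \<in> M \<rightarrow>\<^sub>M PiM K S" and Y: "(\<lambda>\<omega>. \<lambda>j\<in>L. Y j \<omega>) \<in> M \<rightarrow>\<^sub>M PiM L T"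
    using assms(1) by (auto simp: indep_rv_iff_prob)
  have "X k \<in> M \<rightarrow>\<^sub>M S k" "Y l \<in> M \<rightarrow>\<^sub>M T l"
    using measurable_compose[OF X measurable_component_singleton[OF \<open>k \<in> K\<close>]]
      measurable_compose[OF Y measurable_component_singleton[OF \<open>l \<in> L\<close>]] assms(2,3) by simp_all
  moreover have "prob ((X k -` A \<inter> space M) \<inter> (Y l -` C \<inter> space M)) =
      prob (X k -` A \<inter> space M) * prob (Y l -` C \<inter> space M)"
    if A: "A \<in> sets (S k)" and C: "C \<in> sets (T l)" for A C
  proof -
    have preX: "(\<lambda>\<omega>. \<lambda>j\<in>K. X j \<omega>) -` ((\<lambda>f. f k) -` A \<inter> space (PiM K S)) \<inter> space M = X k -` A \<inter> space M"
      using measurable_space[OF X] \<open>k \<in> K\<close> by auto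
    have preY: "(\<lambda>\<omega>. \<lambda>j\<in>L. Y j \<omega>) -` ((\<lambda>f. f l) -` C \<inter> space (PiM L T)) \<inter> space M = Y l -` C \<inter> space M"
      using measurable_space[OF Y] \<open>l \<in> L\<close> by auto
    have A': "(\<lambda>f. f k) -` A \<inter> space (PiM K S) \<in> sets (PiM K S)"
      by (rule measurable_sets[where A = "S k"]) (use \<open>k \<in> K\<close> A in auto)
    have C': "(\<lambda>f. f l) -` C \<inter> space (PiM L T) \<in> sets (PiM L T)"
      by (rule measurable_sets[where A = "T l"]) (use \<open>l \<in> L\<close> C in auto)
    show ?thesis
      by (rule indep_rvD[OF assms(1) A' C', unfolded preX preY])
  qed
  ultimately show ?thesis by (simp add: indep_rv_iff_prob)
qed

text \<open>A cylinder event for the combined sequence splits, by the independence of \<open>Z0\<close> from the rest and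
  of the two sequences from each other, into a factor for \<open>Z0\<close> and one cylinder event for each
  sequence. Such events with rectangular sides suffice, since they generate and are stable under
  intersection. The entry \<open>c\<close> pads the starting value so that all members of the sequence have the
  same type.\<close>

lemma indep_vars_start_and_steps:
  fixes Z0 :: "'a \<Rightarrow> 'b::countable" and X :: "nat \<Rightarrow> 'a \<Rightarrow> 'b" and I :: "nat \<Rightarrow> 'a \<Rightarrow> 'c::countable"
  assumes X: "indep_vars (\<lambda>_. count_space UNIV) X {1..}"
    and I: "indep_vars (\<lambda>_. count_space UNIV) I {1..}"
    and I_X: "indep_rv M
        (PiM {1..} (\<lambda>_. count_space UNIV)) (\<lambda>\<omega>. \<lambda>j\<in>{1..}. I j \<omega>)
        (PiM {1..} (\<lambda>_. count_space UNIV)) (\<lambda>\<omega>. \<lambda>j\<in>{1..}. X j \<omega>)"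
    and Z0: "indep_rv M
        (count_space UNIV) Z0
        (PiM {1..} (\<lambda>_. count_space UNIV) \<Otimes>\<^sub>M PiM {1..} (\<lambda>_. count_space UNIV))
        (\<lambda>\<omega>. (\<lambda>j\<in>{1..}. I j \<omega>, \<lambda>j\<in>{1..}. X j \<omega>))"
  shows "indep_vars (\<lambda>_. count_space UNIV)
    (\<lambda>j \<omega>. if j = 0 then (Z0 \<omega>, c) else (X j \<omega>, I j \<omega>)) {..n}"
proof -
  define Y where "Y j \<omega> = (if j = 0 then (Z0 \<omega>, c) else (X j \<omega>, I j \<omega>))" for j :: nat and \<omega>
  define E :: "('b \<times> 'c) set set" where "E = {a \<times> b | a b. True}"
  have X_rv [measurable]: "X j \<in> M \<rightarrow>\<^sub>M count_space UNIV" if "j \<ge> 1" for j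
    using X that by (auto simp: indep_vars_def)
  have I_rv [measurable]: "I j \<in> M \<rightarrow>\<^sub>M count_space UNIV" if "j \<ge> 1" for j
    using I that by (auto simp: indep_vars_def)
  have Z0_rv [measurable]: "Z0 \<in> M \<rightarrow>\<^sub>M count_space UNIV"
    using Z0 by (simp add: indep_rv_iff_prob)
  have pair_space: "count_space (UNIV :: ('b \<times> 'c) set) = count_space UNIV \<Otimes>\<^sub>M count_space UNIV"
    by (simp add: pair_measure_countable)
  have Y_rv: "Y j \<in> M \<rightarrow>\<^sub>M count_space UNIV" for j
  proof (cases "j = 0")
    case True
    then show ?thesis unfolding Y_def pair_space by simp
  next
    case False
    then have "j \<ge> 1" by simp
    then show ?thesis
      using False X_rv I_rv unfolding Y_def pair_space by (simp add: measurable_Pair)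
  qed
  have prob_cylinder: "prob {\<omega> \<in> space M. \<forall>j\<in>{1..n}. V j \<omega> \<in> A j} =
      (\<Prod>j\<in>{1..n}. prob {\<omega> \<in> space M. V j \<omega> \<in> A j})"
    if V: "indep_vars (\<lambda>_. count_space UNIV) V {1..}" for V :: "nat \<Rightarrow> 'a \<Rightarrow> 'e" and A
  proof (cases "n = 0")
    case True
    then show ?thesis by (simp add: prob_space)
  next
    case False
    have "prob (\<Inter>j\<in>{1..n}. V j -` A j \<inter> space M) = (\<Prod>j\<in>{1..n}. prob (V j -` A j \<inter> space M))"
      using False by (intro indep_varsD[OF V]) auto
    moreover have "(\<Inter>j\<in>{1..n}. V j -` A j \<inter> space M) = {\<omega> \<in> space M. \<forall>j\<in>{1..n}. V j \<omega> \<in> A j}"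
      using False by fastforce
    moreover have "V j -` A j \<inter> space M = {\<omega> \<in> space M. V j \<omega> \<in> A j}" for j by auto
    ultimately show ?thesis by simp
  qed
  have "indep_vars (\<lambda>_. count_space UNIV) Y {..n}"
  proof (subst indep_vars_finite[where E = "\<lambda>_. E"])
    have "sets (count_space UNIV \<Otimes>\<^sub>M count_space UNIV) = sigma_sets UNIV E"
      unfolding sets_pair_measure E_def by simp
    then show "sets (count_space UNIV) = sigma_sets (space (count_space UNIV)) E"
      unfolding pair_space[symmetric] by simp
    show "Int_stable E"
    proof (rule Int_stableI)
      fix A C assume "A \<in> E" "C \<in> E"
      then obtain a b a' b' where "A = a \<times> b" "C = a' \<times> b'" by (auto simp: E_def)
      then have "A \<inter> C = (a \<inter> a') \<times> (b \<inter> b')" by auto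
      then show "A \<inter> C \<in> E" by (auto simp: E_def)
    qed
    show "space (count_space UNIV) \<in> E"
      by (auto simp: E_def intro!: exI[of _ UNIV])
    show "\<forall>A\<in>{..n} \<rightarrow> E. prob (\<Inter>j\<in>{..n}. Y j -` A j \<inter> space M) =
        (\<Prod>j\<in>{..n}. prob (Y j -` A j \<inter> space M))"
    proof
      fix A assume "A \<in> {..n} \<rightarrow> E"
      then have "\<forall>j\<in>{..n}. \<exists>ab. A j = fst ab \<times> snd ab" by (force simp: E_def Pi_iff)
      then obtain ab where ab: "\<And>j. j \<le> n \<Longrightarrow> A j = fst (ab j) \<times> snd (ab j)"
        by (metis atMost_iff)
      define a b where "a j = fst (ab j)" and "b j = snd (ab j)" for j
      have A: "A j = a j \<times> b j" if "j \<le> n" for j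
        using ab that by (simp add: a_def b_def)
      define D where "D = {z. (z, c) \<in> A 0}"
      define CI where "CI = {f \<in> space (PiM {1..} (\<lambda>_. count_space UNIV)). \<forall>j\<in>{1..n}. f j \<in> b j}"
      define CX where "CX = {f \<in> space (PiM {1..} (\<lambda>_. count_space UNIV)). \<forall>j\<in>{1..n}. f j \<in> a j}"
      have CI: "CI \<in> sets (PiM {1..} (\<lambda>_. count_space UNIV))" unfolding CI_def by measurable
      have CX: "CX \<in> sets (PiM {1..} (\<lambda>_. count_space UNIV))" unfolding CX_def by measurable
      have pre_I: "(\<lambda>\<omega>. \<lambda>j\<in>{1..}. I j \<omega>) -` CI \<inter> space M = {\<omega> \<in> space M. \<forall>j\<in>{1..n}. I j \<omega> \<in> b j}"
        by (auto simp: CI_def space_PiM)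
      have pre_X: "(\<lambda>\<omega>. \<lambda>j\<in>{1..}. X j \<omega>) -` CX \<inter> space M = {\<omega> \<in> space M. \<forall>j\<in>{1..n}. X j \<omega> \<in> a j}"
        by (auto simp: CX_def space_PiM)
      have pre_IX: "(\<lambda>\<omega>. (\<lambda>j\<in>{1..}. I j \<omega>, \<lambda>j\<in>{1..}. X j \<omega>)) -` (CI \<times> CX) \<inter> space M =
          {\<omega> \<in> space M. \<forall>j\<in>{1..n}. I j \<omega> \<in> b j} \<inter> {\<omega> \<in> space M. \<forall>j\<in>{1..n}. X j \<omega> \<in> a j}"
        using pre_I pre_X by auto
      have split: "{..n} = insert 0 {1..n}" by auto
      have inter: "(\<Inter>j\<in>{..n}. Y j -` A j \<inter> space M) = (Z0 -` D \<inter> space M) \<inter>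
          ({\<omega> \<in> space M. \<forall>j\<in>{1..n}. I j \<omega> \<in> b j} \<inter> {\<omega> \<in> space M. \<forall>j\<in>{1..n}. X j \<omega> \<in> a j})"
        unfolding split by (auto simp: Y_def D_def A)
      have step: "prob (Y j -` A j \<inter> space M) =
          prob {\<omega> \<in> space M. I j \<omega> \<in> b j} * prob {\<omega> \<in> space M. X j \<omega> \<in> a j}" if j: "j \<in> {1..n}" for j
      proof -
        have IX: "indep_rv M (count_space UNIV) (I j) (count_space UNIV) (X j)"
          using indep_rv_components[OF I_X, of j j] j by simp
        have "Y j -` A j \<inter> space M = (I j -` b j \<inter> space M) \<inter> (X j -` a j \<inter> space M)"
          using j by (auto simp: Y_def A)
        then show ?thesis
          using indep_rvD[OF IX, of "b j" "a j"] by (simp add: vimage_def Int_def conj_commute)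
      qed
      have "prob (\<Inter>j\<in>{..n}. Y j -` A j \<inter> space M) = prob (Z0 -` D \<inter> space M) *
          (prob {\<omega> \<in> space M. \<forall>j\<in>{1..n}. I j \<omega> \<in> b j} * prob {\<omega> \<in> space M. \<forall>j\<in>{1..n}. X j \<omega> \<in> a j})"
        using indep_rvD[OF Z0, of D "CI \<times> CX"] indep_rvD[OF I_X CI CX] CI CX
        unfolding inter pre_IX pre_I pre_X by simp
      also have "\<dots> = prob (Y 0 -` A 0 \<inter> space M) * (\<Prod>j\<in>{1..n}. prob (Y j -` A j \<inter> space M))"
      proof -
        have "Z0 -` D \<inter> space M = Y 0 -` A 0 \<inter> space M" by (auto simp: Y_def D_def)
        moreover have "(\<Prod>j\<in>{1..n}. prob (Y j -` A j \<inter> space M)) =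
            (\<Prod>j\<in>{1..n}. prob {\<omega> \<in> space M. I j \<omega> \<in> b j} * prob {\<omega> \<in> space M. X j \<omega> \<in> a j})"
          by (rule prod.cong[OF refl step])
        ultimately show ?thesis
          unfolding prob_cylinder[OF I] prob_cylinder[OF X] prod.distrib by (simp only:)
      qed
      also have "\<dots> = (\<Prod>j\<in>{..n}. prob (Y j -` A j \<inter> space M))"
        unfolding split by (subst prod.insert) auto
      finally show "prob (\<Inter>j\<in>{..n}. Y j -` A j \<inter> space M) =
          (\<Prod>j\<in>{..n}. prob (Y j -` A j \<inter> space M))" .
    qed
  qed (use Y_rv in auto)
  then show ?thesis unfolding Y_def .
qed

section \<open>The lazy walk\<close>

text \<open>A partial sum is a function of the variables with index at most \<open>n\<close>, hence independent of the
  variable with index \<open>n + 1\<close>. The measurability conditions are trivial because a finite product of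
  countable discrete spaces is discrete.\<close>

lemma indep_rv_partial_sum_next_step:
  fixes Z0 :: "'a \<Rightarrow> int ^ 'd" and X :: "nat \<Rightarrow> 'a \<Rightarrow> int ^ 'd" and I :: "nat \<Rightarrow> 'a \<Rightarrow> int"
  assumes indep: "indep_vars (\<lambda>_. count_space UNIV)
    (\<lambda>j \<omega>. if j = 0 then (Z0 \<omega>, c) else (X j \<omega>, I j \<omega>)) {..Suc n}"
  shows "indep_rv M
    (count_space UNIV) (\<lambda>\<omega>. Z0 \<omega> + (\<Sum>j = 1..n. I j \<omega> *s X j \<omega>))
    (count_space UNIV) (\<lambda>\<omega>. (X (Suc n) \<omega>, I (Suc n) \<omega>))"
proof -
  define Y where "Y j \<omega> = (if j = 0 then (Z0 \<omega>, c) else (X j \<omega>, I j \<omega>))" for j :: nat and \<omega>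
  define F where "F y = fst (y 0) + (\<Sum>j = 1..n. snd (y j) *s fst (y j))"
    for y :: "nat \<Rightarrow> (int ^ 'd) \<times> int"
  define W where "W = (\<lambda>\<omega>. \<lambda>j\<in>{..n}. Y j \<omega>)"
  define W' where "W' = (\<lambda>\<omega>. \<lambda>j\<in>{Suc n}. Y j \<omega>)"
  let ?P = "\<lambda>K. PiM K (\<lambda>_. count_space (UNIV :: ((int ^ 'd) \<times> int) set))"
  have discrete: "?P K = count_space (PiE K (\<lambda>_. UNIV))" if "finite K" for K :: "nat set"
    using that by (intro count_space_PiM_finite) auto
  have "indep_var (?P {..n}) W (?P {Suc n}) W'"
    unfolding W_def W'_def
    by (rule indep_var_restrict[OF indep[folded Y_def]]) auto
  then have indep_W: "indep_rv M (?P {..n}) W (?P {Suc n}) W'"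
    by (simp add: indep_rv_iff_indep_var)
  then have W: "W \<in> M \<rightarrow>\<^sub>M ?P {..n}" and W': "W' \<in> M \<rightarrow>\<^sub>M ?P {Suc n}"
    by (auto simp: indep_rv_iff_prob)
  have S: "(\<lambda>\<omega>. Z0 \<omega> + (\<Sum>j = 1..n. I j \<omega> *s X j \<omega>)) = (\<lambda>\<omega>. F (W \<omega>))"
    by (auto simp: F_def W_def Y_def intro!: ext sum.cong)
  have T: "(\<lambda>\<omega>. (X (Suc n) \<omega>, I (Suc n) \<omega>)) = (\<lambda>\<omega>. W' \<omega> (Suc n))"
    by (auto simp: W'_def Y_def)
  have F_rv: "F \<in> ?P {..n} \<rightarrow>\<^sub>M count_space UNIV" by (simp add: discrete)
  have eval_rv: "(\<lambda>y. y (Suc n)) \<in> ?P {Suc n} \<rightarrow>\<^sub>M count_space UNIV" by (simp add: discrete)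
  have pre: "(\<lambda>\<omega>. F (W \<omega>)) -` A \<inter> space M = W -` (F -` A \<inter> space (?P {..n})) \<inter> space M"
    "(\<lambda>\<omega>. W' \<omega> (Suc n)) -` C \<inter> space M =
      W' -` ((\<lambda>y. y (Suc n)) -` C \<inter> space (?P {Suc n})) \<inter> space M" for A C
    using measurable_space[OF W] measurable_space[OF W'] by auto
  show ?thesis
    unfolding S T indep_rv_iff_prob
  proof (intro conjI ballI)
    show "(\<lambda>\<omega>. F (W \<omega>)) \<in> M \<rightarrow>\<^sub>M count_space UNIV" by (rule measurable_compose[OF W F_rv])
    show "(\<lambda>\<omega>. W' \<omega> (Suc n)) \<in> M \<rightarrow>\<^sub>M count_space UNIV" by (rule measurable_compose[OF W' eval_rv])
  qed (unfold pre, rule indep_rvD[OF indep_W measurable_sets[OF F_rv] measurable_sets[OF eval_rv]])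
qed

text \<open>The two values of \<open>I\<close> split the event, and the value of \<open>X\<close> splits its part with \<open>I = 1\<close>; each
  piece prescribes the values of \<open>S\<close> and of \<open>I\<close> or \<open>(X, I)\<close>, so that its probability factors.\<close>

lemma prob_lazy_step:
  fixes S X :: "'a \<Rightarrow> int ^ 'd" and I :: "'a \<Rightarrow> int"
  assumes "finite B" and X_in: "AE \<omega> in M. X \<omega> \<in> B"
    and I_01: "AE \<omega> in M. I \<omega> \<in> {0, 1}"
    and I_X: "indep_rv M (count_space UNIV) I (count_space UNIV) X"
    and S_XI: "indep_rv M (count_space UNIV) S (count_space UNIV) (\<lambda>\<omega>. (X \<omega>, I \<omega>))"
  shows "prob {\<omega> \<in> space M. S \<omega> + I \<omega> *s X \<omega> = v} =
    (1 - expectation (\<lambda>\<omega>. real_of_int (I \<omega>))) * prob {\<omega> \<in> space M. S \<omega> = v}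
    + expectation (\<lambda>\<omega>. real_of_int (I \<omega>)) *
      (\<Sum>x\<in>B. prob {\<omega> \<in> space M. X \<omega> = x} * prob {\<omega> \<in> space M. S \<omega> = v - x})"
proof -
  let ?q = "expectation (\<lambda>\<omega>. real_of_int (I \<omega>))"
  have [measurable]: "S \<in> M \<rightarrow>\<^sub>M count_space UNIV" "X \<in> M \<rightarrow>\<^sub>M count_space UNIV"
    "I \<in> M \<rightarrow>\<^sub>M count_space UNIV"
    using I_X S_XI by (auto simp: indep_rv_iff_prob)
  have [measurable]: "(\<lambda>\<omega>. S \<omega> + I \<omega> *s X \<omega>) \<in> M \<rightarrow>\<^sub>M count_space UNIV"
    by (rule measurable_compose_countable[where g = S],
        rule measurable_compose_countable[where g = I]) measurable
  have int: "integrable M (\<lambda>\<omega>. indicator A \<omega> :: real)" if "A \<in> sets M" for A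
    using that by (intro integrable_real_indicator) (simp_all add: emeasure_eq_measure)
  have one: "prob {\<omega> \<in> space M. I \<omega> = 1} = ?q"
  proof -
    have "?q = expectation (indicator {\<omega> \<in> space M. I \<omega> = 1})"
    proof (rule integral_cong_AE)
      show "AE \<omega> in M. real_of_int (I \<omega>) = indicator {\<omega> \<in> space M. I \<omega> = 1} \<omega>"
        using I_01 by (rule AE_mp) (auto intro!: AE_I2 simp: indicator_def)
    qed measurable
    then show ?thesis by (simp add: Int_absorb2)
  qed
  have zero: "prob {\<omega> \<in> space M. I \<omega> = 0} = 1 - ?q"
  proof -
    have "prob {\<omega> \<in> space M. I \<omega> = 0} = prob (space M - {\<omega> \<in> space M. I \<omega> = 1})"
      by (rule finite_measure_eq_AE) (use I_01 in auto)
    then show ?thesis by (simp add: prob_compl one)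
  qed
  have indep_S: "prob {\<omega> \<in> space M. S \<omega> = w \<and> (X \<omega>, I \<omega>) \<in> C} =
      prob {\<omega> \<in> space M. S \<omega> = w} * prob {\<omega> \<in> space M. (X \<omega>, I \<omega>) \<in> C}" for w C
  proof -
    have "(S -` {w} \<inter> space M) \<inter> ((\<lambda>\<omega>. (X \<omega>, I \<omega>)) -` C \<inter> space M) =
        {\<omega> \<in> space M. S \<omega> = w \<and> (X \<omega>, I \<omega>) \<in> C}"
      "S -` {w} \<inter> space M = {\<omega> \<in> space M. S \<omega> = w}"
      "(\<lambda>\<omega>. (X \<omega>, I \<omega>)) -` C \<inter> space M = {\<omega> \<in> space M. (X \<omega>, I \<omega>) \<in> C}" by auto
    then show ?thesis using indep_rvD[OF S_XI, of "{w}" C] by simp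
  qed
  have stay: "prob {\<omega> \<in> space M. S \<omega> = v \<and> I \<omega> = 0} = (1 - ?q) * prob {\<omega> \<in> space M. S \<omega> = v}"
    using indep_S[of v "UNIV \<times> {0}"] by (simp add: zero)
  have move: "prob {\<omega> \<in> space M. S \<omega> = v - x \<and> X \<omega> = x \<and> I \<omega> = 1} =
      ?q * (prob {\<omega> \<in> space M. X \<omega> = x} * prob {\<omega> \<in> space M. S \<omega> = v - x})" for x
  proof -
    have "(I -` {1} \<inter> space M) \<inter> (X -` {x} \<inter> space M) = {\<omega> \<in> space M. X \<omega> = x \<and> I \<omega> = 1}"
      "I -` {1} \<inter> space M = {\<omega> \<in> space M. I \<omega> = 1}"
      "X -` {x} \<inter> space M = {\<omega> \<in> space M. X \<omega> = x}" by auto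
    then have "prob {\<omega> \<in> space M. X \<omega> = x \<and> I \<omega> = 1} = ?q * prob {\<omega> \<in> space M. X \<omega> = x}"
      using indep_rvD[OF I_X, of "{1}" "{x}"] by (simp add: one)
    then show ?thesis using indep_S[of "v - x" "{(x, 1)}"] by simp
  qed
  have "prob {\<omega> \<in> space M. S \<omega> + I \<omega> *s X \<omega> = v} =
      expectation (indicator {\<omega> \<in> space M. S \<omega> + I \<omega> *s X \<omega> = v})"
    by (simp add: Int_absorb2)
  also have "\<dots> = expectation (\<lambda>\<omega>. indicator {\<omega> \<in> space M. S \<omega> = v \<and> I \<omega> = 0} \<omega> +
      (\<Sum>x\<in>B. indicator {\<omega> \<in> space M. S \<omega> = v - x \<and> X \<omega> = x \<and> I \<omega> = 1} \<omega>))"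
  proof (rule integral_cong_AE)
    show "AE \<omega> in M. indicator {\<omega> \<in> space M. S \<omega> + I \<omega> *s X \<omega> = v} \<omega> =
        (indicator {\<omega> \<in> space M. S \<omega> = v \<and> I \<omega> = 0} \<omega> +
          (\<Sum>x\<in>B. indicator {\<omega> \<in> space M. S \<omega> = v - x \<and> X \<omega> = x \<and> I \<omega> = 1} \<omega>) :: real)"
      using X_in I_01
    proof eventually_elim
      case (elim \<omega>)
      show ?case
      proof (cases "\<omega> \<in> space M")
        case True
        have "(\<Sum>x\<in>B. indicator {\<omega> \<in> space M. S \<omega> = v - x \<and> X \<omega> = x \<and> I \<omega> = 1} \<omega> :: real) =
            (\<Sum>x\<in>B. if x = X \<omega> then indicator {\<omega> \<in> space M. S \<omega> = v - X \<omega> \<and> I \<omega> = 1} \<omega> else 0)"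
          by (intro sum.cong) (auto simp: indicator_def)
        also have "\<dots> = indicator {\<omega> \<in> space M. S \<omega> = v - X \<omega> \<and> I \<omega> = 1} \<omega>"
          using \<open>finite B\<close> elim by (simp add: sum.delta)
        finally show ?thesis
          using elim True by (auto simp: indicator_def algebra_simps)
      qed (simp add: indicator_def)
    qed
  qed measurable
  also have "\<dots> = prob {\<omega> \<in> space M. S \<omega> = v \<and> I \<omega> = 0} +
      (\<Sum>x\<in>B. prob {\<omega> \<in> space M. S \<omega> = v - x \<and> X \<omega> = x \<and> I \<omega> = 1})"
  proof -
    have "{\<omega> \<in> space M. S \<omega> = v \<and> I \<omega> = 0} \<in> sets M"
      "\<And>x. {\<omega> \<in> space M. S \<omega> = v - x \<and> X \<omega> = x \<and> I \<omega> = 1} \<in> sets M"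
      by measurable
    note this [THEN int]
    then show ?thesis
      by (simp add: Bochner_Integration.integral_add Bochner_Integration.integral_sum Int_absorb2)
  qed
  finally show ?thesis
    by (simp add: stay move sum_distrib_left)
qed

lemma prob_eq_pmf:
  assumes "distr M (count_space UNIV) X = measure_pmf p" "X \<in> M \<rightarrow>\<^sub>M count_space UNIV"
  shows "prob {\<omega> \<in> space M. X \<omega> = x} = pmf p x"
proof -
  have "pmf p x = measure (distr M (count_space UNIV) X) {x}"
    by (simp add: assms(1) measure_pmf_single)
  also have "\<dots> = prob {\<omega> \<in> space M. X \<omega> = x}"
    using assms(2) by (simp add: measure_distr vimage_def Int_def conj_commute)
  finally show ?thesis by simp
qed

end

section \<open>Equality of the two laws\<close>

lemma distr_eqI_countable:
  fixes X :: "'a \<Rightarrow> 'c::countable" and Y :: "'b \<Rightarrow> 'c"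
  assumes "prob_space M" "prob_space N"
    and "X \<in> M \<rightarrow>\<^sub>M count_space UNIV" "Y \<in> N \<rightarrow>\<^sub>M count_space UNIV"
    and "\<And>v. measure M {\<omega> \<in> space M. X \<omega> = v} = measure N {\<omega> \<in> space N. Y \<omega> = v}"
  shows "distr M (count_space UNIV) X = distr N (count_space UNIV) Y"
proof (rule measure_eqI_countable[where A = UNIV])
  interpret M: prob_space M by fact
  interpret N: prob_space N by fact
  fix v
  have "X -` {v} \<inter> space M = {\<omega> \<in> space M. X \<omega> = v}"
    "Y -` {v} \<inter> space N = {\<omega> \<in> space N. Y \<omega> = v}" by auto
  then show "emeasure (distr M (count_space UNIV) X) {v} = emeasure (distr N (count_space UNIV) Y) {v}"
    using assms(3-5) by (simp add: emeasure_distr M.emeasure_eq_measure N.emeasure_eq_measure)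
qed auto

theorem theorem11:
  fixes M :: "'w measure"
    and N :: "'s measure"
    and p u0 :: "(int ^ 'd) pmf"
    and B :: "(int ^ 'd) set"
    and U :: "nat \<Rightarrow> 'w \<Rightarrow> int ^ 'd \<Rightarrow> real"
    and Z :: "nat \<Rightarrow> 'w \<Rightarrow> int ^ 'd"
    and X :: "nat \<Rightarrow> 's \<Rightarrow> int ^ 'd"
    and I :: "nat \<Rightarrow> 's \<Rightarrow> int"
    and Z0 :: "'s \<Rightarrow> int ^ 'd"
    and n :: nat
  assumes B: "finite B" "B \<noteq> {}" "\<And>u. u \<notin> B \<Longrightarrow> pmf p u = 0"
    and urn: "infinite_color_urn M p u0 U Z"
    and N: "prob_space N"
    and X_indep: "prob_space.indep_vars N (\<lambda>_. count_space UNIV) X {1..}"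
    and X_distr: "\<And>j. j \<ge> 1 \<Longrightarrow> distr N (count_space UNIV) (X j) = measure_pmf p"
    and Sigma: "positive_definite (second_moment_matrix N (X 1))"
    and I_indep: "prob_space.indep_vars N (\<lambda>_. count_space UNIV) I {1..}"
    and I_bernoulli: "\<And>j. j \<ge> 1 \<Longrightarrow> AE \<omega> in N. I j \<omega> \<in> {0, 1}"
    and I_mean: "\<And>j. j \<ge> 1 \<Longrightarrow> (\<integral>\<omega>. real_of_int (I j \<omega>) \<partial>N) = 1 / (real j + 1)"
    and I_X_indep: "indep_rv N
        (PiM {1..} (\<lambda>_. count_space UNIV)) (\<lambda>\<omega>. \<lambda>j\<in>{1..}. I j \<omega>)
        (PiM {1..} (\<lambda>_. count_space UNIV)) (\<lambda>\<omega>. \<lambda>j\<in>{1..}. X j \<omega>)"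
    and Z0_distr: "distr N (count_space UNIV) Z0 = measure_pmf u0"
    and Z0_indep: "indep_rv N
        (count_space UNIV) Z0
        (PiM {1..} (\<lambda>_. count_space UNIV) \<Otimes>\<^sub>M PiM {1..} (\<lambda>_. count_space UNIV))
        (\<lambda>\<omega>. (\<lambda>j\<in>{1..}. I j \<omega>, \<lambda>j\<in>{1..}. X j \<omega>))"
    and n: "n \<ge> 1"
  shows "distr M (count_space UNIV) (Z n) =
         distr N (count_space UNIV) (\<lambda>\<omega>. Z0 \<omega> + (\<Sum>j = 1..n. I j \<omega> *s X j \<omega>))"
proof -
  interpret urn: infinite_color_urn M p u0 U Z by (rule urn)
  interpret N: prob_space N by (rule N)
  define S where "S m \<omega> = Z0 \<omega> + (\<Sum>j = 1..m. I j \<omega> *s X j \<omega>)" for m \<omega>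
  have S_Suc: "S (Suc m) \<omega> = S m \<omega> + I (Suc m) \<omega> *s X (Suc m) \<omega>" for m \<omega>
    by (simp add: S_def algebra_simps)
  have X_rv: "X j \<in> N \<rightarrow>\<^sub>M count_space UNIV" if "j \<ge> 1" for j
    using X_indep that by (auto simp: N.indep_vars_def)
  have Z0_rv: "Z0 \<in> N \<rightarrow>\<^sub>M count_space UNIV"
    using Z0_indep by (simp add: indep_rv_def)
  have X_in: "AE \<omega> in N. X j \<omega> \<in> B" if "j \<ge> 1" for j
  proof -
    have "x \<in> B" if "x \<in> set_pmf p" for x
      using B(3)[of x] that by (cases "x \<in> B") (simp_all add: set_pmf_iff)
    then have "AE x in distr N (count_space UNIV) (X j). x \<in> B"
      unfolding X_distr[OF that] AE_measure_pmf_iff by simp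
    then show ?thesis
      by (subst (asm) AE_distr_iff[OF X_rv[OF that]]) simp_all
  qed
  have S_step: "indep_rv N (count_space UNIV) (S m)
      (count_space UNIV) (\<lambda>\<omega>. (X (Suc m) \<omega>, I (Suc m) \<omega>))" for m
    unfolding S_def
    by (rule N.indep_rv_partial_sum_next_step[where c = 0])
      (rule N.indep_vars_start_and_steps[OF X_indep I_indep I_X_indep Z0_indep])
  have "urn.prob {\<omega> \<in> space M. Z m \<omega> = v} = N.prob {\<omega> \<in> space N. S m \<omega> = v}" for m v
  proof (induction m arbitrary: v)
    case 0
    show ?case by (simp add: urn.prob_draw_0 S_def N.prob_eq_pmf[OF Z0_distr Z0_rv])
  next
    case (Suc m)
    have "indep_rv N (count_space UNIV) (I (Suc m)) (count_space UNIV) (X (Suc m))"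
      using N.indep_rv_components[OF I_X_indep, of "Suc m" "Suc m"] by simp
    from N.prob_lazy_step[OF B(1) X_in I_bernoulli this S_step, of v]
    show ?case
      by (simp add: S_Suc I_mean urn.prob_draw_Suc[OF B(1,3)] Suc
          N.prob_eq_pmf[OF X_distr X_rv] add.commute)
  qed
  moreover have "S n \<in> N \<rightarrow>\<^sub>M count_space UNIV"
    using S_step[of n] by (simp add: indep_rv_def)
  ultimately show ?thesis
    unfolding S_def[symmetric, abs_def]
    by (intro distr_eqI_countable urn.Z_measurable urn.prob_space_axioms N)
qed

end
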